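(* Let $n\ge 10$. Then $\mathbb{E}(P_n(2,2,2,n-7))<\mathbb{E}(P_n(2,1,n-4))$.
   Context: The energy $\mathbb{E}(G)$ is the sum of absolute values of the adjacency eigenvalues of $G$. $P_n(a_1,\dots,a_k)$ ($k\ge3$, $a_i\ge1$, $\sum a_i=n-1$) is the tree of order $n$ consisting of a central vertex with $k$ internally disjoint pendent paths of lengths $a_1,\dots,a_k$. *)

theory Defs
  imports "Jordan_Normal_Form.Spectral_Radius" "Graph_Theory.Graph_Theory"
begin

text \<open>Simple graphs are symmetric loop-free digraphs (locale \<^locale>\<open>pair_graph\<close>), so every
  edge is represented by two opposite arcs.\<close>

text \<open>Rows and columns follow the increasing order of the vertices; another order would only
  conjugate the matrix by a permutation.\<close>

definition adjacency_mat :: "'a :: linorder pair_pre_digraph \<Rightarrow> complex mat" where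
  "adjacency_mat G = (let vs = sorted_list_of_set (pverts G) in
     mat (length vs) (length vs) (\<lambda>(i, j). if (vs ! i, vs ! j) \<in> parcs G then 1 else 0))"

text \<open>Eigenvalues are counted with (algebraic) multiplicity.\<close>

definition energy :: "'a :: linorder pair_pre_digraph \<Rightarrow> real" where
  "energy G = (\<Sum>x \<in> spectrum (adjacency_mat G).
     real (order x (char_poly (adjacency_mat G))) * cmod x)"

text \<open>The vertex at distance \<open>j\<close> from the centre \<open>0\<close> on the \<open>i\<close>-th pendent path, where the paths
  have lengths \<open>as\<close> (counted from \<open>i = 0\<close>) and are numbered one after the other.\<close>

definition arm_vertex :: "nat list \<Rightarrow> nat \<Rightarrow> nat \<Rightarrow> nat" where
  "arm_vertex as i j = (if j = 0 then 0 else sum_list (take i as) + j)"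

text \<open>\<open>starlike_tree [a\<^sub>1, \<dots>, a\<^sub>k]\<close> is \<open>P\<^sub>n(a\<^sub>1, \<dots>, a\<^sub>k)\<close>
  with \<open>n = 1 + a\<^sub>1 + \<dots> + a\<^sub>k\<close>.\<close>

definition starlike_tree :: "nat list \<Rightarrow> nat pair_pre_digraph" where
  "starlike_tree as = \<lparr> pverts = {0..sum_list as},
     parcs = {(u, v). \<exists>i < length as. \<exists>j < as ! i.
       {u, v} = {arm_vertex as i j, arm_vertex as i (Suc j)}} \<rparr>"

lemma card_pverts_starlike_tree: "card (pverts (starlike_tree as)) = 1 + sum_list as"
  by (simp add: starlike_tree_def)

lemma arm_vertex_le:
  assumes "i < length as" "j \<le> as ! i"
  shows "arm_vertex as i j \<le> sum_list as"
proof -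
  have "sum_list as = sum_list (take i as) + as ! i + sum_list (drop (Suc i) as)"
    using assms(1) by (metis id_take_nth_drop sum_list.Cons sum_list_append add.assoc)
  then show ?thesis using assms(2) by (auto simp: arm_vertex_def)
qed

lemma pair_graph_starlike_tree: "pair_graph (starlike_tree as)"
proof -
  have arcs: "u \<le> sum_list as \<and> v \<le> sum_list as \<and> u \<noteq> v"
    if "(u, v) \<in> parcs (starlike_tree as)" for u v
  proof -
    from that obtain i j where ij: "i < length as" "j < as ! i"
      and uv: "{u, v} = {arm_vertex as i j, arm_vertex as i (Suc j)}"
      by (auto simp: starlike_tree_def)
    have "arm_vertex as i j \<noteq> arm_vertex as i (Suc j)"
      by (simp add: arm_vertex_def)
    moreover have "arm_vertex as i j \<le> sum_list as" "arm_vertex as i (Suc j) \<le> sum_list as"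
      using ij by (simp_all add: arm_vertex_le)
    ultimately show ?thesis using uv by (auto simp: doubleton_eq_iff)
  qed
  have "parcs (starlike_tree as) \<subseteq> {0..sum_list as} \<times> {0..sum_list as}"
    using arcs by auto
  then have fin: "finite (parcs (starlike_tree as))"
    by (rule finite_subset) simp
  have sym: "symmetric (starlike_tree as)"
    unfolding symmetric_def sym_def
    by (auto simp: starlike_tree_def insert_commute)
  have verts: "pverts (starlike_tree as) = {0..sum_list as}"
    by (simp add: starlike_tree_def)
  show ?thesis
    by unfold_locales (use arcs fin sym verts in \<open>force+\<close>)
qed

end

theory Submission
  imports Defs "HOL-Real_Asymp.Real_Asymp"
begin

text \<open>By Coulson's method, the energy of a graph is determined by its characteristic polynomial on
  the imaginary axis: \<open>\<pi>\<bar>a\<bar>\<close> is the integral of \<open>ln (1 + a\<^sup>2 / t\<^sup>2)\<close> over \<open>t > 0\<close>, so if two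
  multisets of equal size satisfy \<open>\<Prod>(t\<^sup>2 + a\<^sup>2) \<le> \<Prod>(t\<^sup>2 + b\<^sup>2)\<close> for all \<open>t > 0\<close>, then
  \<open>\<Sum>\<bar>a\<bar> \<le> \<Sum>\<bar>b\<bar>\<close>. The polynomials of the two trees are not comparable in this way. But, with
  \<open>p\<^sub>k\<close> the polynomial of the path on \<open>k\<close> vertices, the quotient of their absolute values at \<open>\<i>t\<close>
  decreases in \<open>\<bar>p\<^bsub>n-7\<^esub> / p\<^bsub>n-8\<^esub>\<bar>\<close>, which for \<open>n \<ge> 10\<close> is largest at \<open>n = 11\<close>; so
  the energy difference is at least the one for \<open>n = 11\<close>, and that one is bounded below by
  rational approximations of the eigenvalues, added as further elements to both multisets.\<close>

section \<open>Determinants with an isolated or pendant last vertex\<close>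

lemma det_last_row_zero:
  fixes A :: "'a :: comm_ring_1 mat"
  assumes A: "A \<in> carrier_mat (Suc n) (Suc n)" and row: "\<And>j. j < n \<Longrightarrow> A $$ (n, j) = 0"
  shows "det A = A $$ (n, n) * det (mat_delete A n n)"
  using laplace_expansion_row[OF A, of n] row by (simp add: cofactor_def)

text \<open>Expanding along the last row leaves columns \<open>n\<close> and \<open>k\<close>; in
  the minor of the latter the last column is zero outside row \<open>k\<close>, and expanding along
  it removes index \<open>k\<close> too.\<close>

lemma det_pendant:
  fixes A :: "'a :: comm_ring_1 mat"
  assumes A: "A \<in> carrier_mat (Suc n) (Suc n)" and k: "k < n"
    and row: "\<And>j. j < n \<Longrightarrow> j \<noteq> k \<Longrightarrow> A $$ (n, j) = 0"
    and col: "\<And>i. i < n \<Longrightarrow> i \<noteq> k \<Longrightarrow> A $$ (i, n) = 0"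
  shows "det A = A $$ (n, n) * det (mat_delete A n n)
    - A $$ (n, k) * A $$ (k, n) * det (mat_delete (mat_delete A n n) k k)"
proof -
  obtain m where m: "n = Suc m" using k by (cases n) auto
  define B where "B = mat_delete A n k"
  have B: "B \<in> carrier_mat n n" unfolding B_def using mat_delete_carrier[OF A] by simp
  \<comment> \<open>Deleting column \<open>k < n\<close> moves column \<open>n\<close> of
    \<open>A\<close> to the last position \<open>m\<close>.\<close>
  have Bent: "B $$ (i, m) = A $$ (i, n)" if "i < n" for i
    using that A k by (auto simp: B_def mat_delete_def m)
  have "det B = (\<Sum>i<n. B $$ (i, m) * cofactor B i m)"
    by (rule laplace_expansion_column[OF B]) (simp add: m)
  also have "\<dots> = (\<Sum>i\<in>{k}. B $$ (i, m) * cofactor B i m)"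
    by (rule sum.mono_neutral_right) (use k col Bent in auto)
  also have "\<dots> = A $$ (k, n) * ((-1) ^ (k + m) * det (mat_delete (mat_delete A n n) k k))"
  proof -
    have "mat_delete B k m = mat_delete (mat_delete A n n) k k"
      using A k by (intro eq_matI) (auto simp: B_def mat_delete_def m)
    then show ?thesis using Bent[OF k] by (simp add: cofactor_def)
  qed
  finally have detB: "det B = \<dots>" .
  have "det A = A $$ (n, n) * cofactor A n n + (\<Sum>j<n. A $$ (n, j) * cofactor A n j)"
    using laplace_expansion_row[OF A, of n] by simp
  also have "(\<Sum>j<n. A $$ (n, j) * cofactor A n j) = (\<Sum>j\<in>{k}. A $$ (n, j) * cofactor A n j)"
    by (rule sum.mono_neutral_right) (use k row in auto)
  also have "\<dots> = A $$ (n, k) * ((-1) ^ (n + k) * det B)"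
    by (simp add: cofactor_def B_def)
  also have "\<dots> = - (A $$ (n, k) * A $$ (k, n) * det (mat_delete (mat_delete A n n) k k))"
  proof -
    \<comment> \<open>As \<open>n = m + 1\<close>, the two cofactor signs are opposite.\<close>
    have "(-1) ^ (n + k) = - ((-1 :: 'a) ^ (k + m))"
      by (simp add: m add.commute)
    then have "(-1) ^ (n + k) * (-1) ^ (k + m) = (-1 :: 'a)"
      by simp
    then show ?thesis unfolding detB by (metis (no_types, lifting) mult.assoc mult.left_commute mult_minus1)
  qed
  finally show ?thesis by (simp add: cofactor_def)
qed

section \<open>Characteristic determinants of starlike trees\<close>

text \<open>For loop-free \<open>E\<close> this is \<open>x\<close> times the identity minus the
  adjacency matrix on the vertices below \<open>n\<close>. Since \<open>E\<close> may reach beyond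
  \<open>n\<close>, deleting the last vertex only changes \<open>n\<close>.\<close>

definition arc_mat :: "'a :: comm_ring_1 \<Rightarrow> (nat \<times> nat) set \<Rightarrow> nat \<Rightarrow> 'a mat" where
  "arc_mat x E n = mat n n (\<lambda>(i, j). if i = j then x else if (i, j) \<in> E then -1 else 0)"

lemma arc_mat_carrier [simp]: "arc_mat x E n \<in> carrier_mat n n"
  by (simp add: arc_mat_def)

lemma arc_mat_cong:
  assumes "\<And>i j. i < n \<Longrightarrow> j < n \<Longrightarrow> i \<noteq> j \<Longrightarrow> (i, j) \<in> E \<longleftrightarrow> (i, j) \<in> E'"
  shows "arc_mat x E n = arc_mat x E' n"
  using assms by (intro eq_matI) (auto simp: arc_mat_def)

lemma mat_delete_arc_mat_last: "mat_delete (arc_mat x E (Suc n)) n n = arc_mat x E n"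
  by (intro eq_matI) (auto simp: arc_mat_def mat_delete_def)

lemma mat_delete_arc_mat_first:
  "mat_delete (arc_mat x E (Suc n)) 0 0 = arc_mat x {(i, j). (Suc i, Suc j) \<in> E} n"
  by (intro eq_matI) (auto simp: arc_mat_def mat_delete_def)

lemma det_arc_mat_isolated:
  assumes "\<And>j. j < n \<Longrightarrow> (n, j) \<notin> E"
  shows "det (arc_mat x E (Suc n)) = x * det (arc_mat x E n)"
  using assms det_last_row_zero[OF arc_mat_carrier[of x E "Suc n"]]
  by (simp add: mat_delete_arc_mat_last) (simp add: arc_mat_def)

lemma det_arc_mat_pendant:
  assumes "k < n" and "\<And>j. j < n \<Longrightarrow> (n, j) \<in> E \<longleftrightarrow> j = k" and "\<And>j. j < n \<Longrightarrow> (j, n) \<in> E \<longleftrightarrow> j = k"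
  shows "det (arc_mat x E (Suc n)) = x * det (arc_mat x E n) - det (mat_delete (arc_mat x E n) k k)"
  using assms det_pendant[OF arc_mat_carrier[of x E "Suc n"] assms(1)]
  by (simp add: mat_delete_arc_mat_last) (simp add: arc_mat_def)

text \<open>The characteristic polynomial of the path on \<open>k\<close> vertices at
  \<open>x\<close>, a Chebyshev polynomial of the second kind at \<open>x / 2\<close>.\<close>

fun path_poly :: "'a :: comm_ring_1 \<Rightarrow> nat \<Rightarrow> 'a" where
  "path_poly x 0 = 1"
| "path_poly x (Suc 0) = x"
| "path_poly x (Suc (Suc k)) = x * path_poly x (Suc k) - path_poly x k"

definition tree_det :: "'a :: comm_ring_1 \<Rightarrow> nat list \<Rightarrow> 'a" where
  "tree_det x as = det (arc_mat x (parcs (starlike_tree as)) (Suc (sum_list as)))"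

text \<open>Row and column 0 belong to the centre, so the disjoint union of the arms
  remains.\<close>

definition forest_det :: "'a :: comm_ring_1 \<Rightarrow> nat list \<Rightarrow> 'a" where
  "forest_det x as = det (mat_delete (arc_mat x (parcs (starlike_tree as)) (Suc (sum_list as))) 0 0)"

text \<open>Appending an arm does not renumber the earlier ones, because \<open>arm_vertex\<close>
  reads only \<open>take i as\<close>.\<close>

lemma arcs_starlike_tree_snoc:
  "(u, v) \<in> parcs (starlike_tree (as @ [k])) \<longleftrightarrow> (u, v) \<in> parcs (starlike_tree as) \<or>
     (\<exists>j<k. {u, v} = {if j = 0 then 0 else sum_list as + j, Suc (sum_list as + j)})"
proof -
  define P where "P bs i = (\<exists>j<bs ! i. {u, v} = {arm_vertex bs i j, arm_vertex bs i (Suc j)})" for bs i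
  have arcs: "(u, v) \<in> parcs (starlike_tree bs) \<longleftrightarrow> (\<exists>i<length bs. P bs i)" for bs
    by (simp add: starlike_tree_def P_def)
  have "P (as @ [k]) i \<longleftrightarrow> P as i" if "i < length as" for i
    using that by (simp add: P_def nth_append arm_vertex_def)
  moreover have "P (as @ [k]) (length as) \<longleftrightarrow>
      (\<exists>j<k. {u, v} = {if j = 0 then 0 else sum_list as + j, Suc (sum_list as + j)})"
    by (simp add: P_def arm_vertex_def)
  moreover have "(\<exists>i<length (as @ [k]). P (as @ [k]) i) \<longleftrightarrow>
      P (as @ [k]) (length as) \<or> (\<exists>i<length as. P (as @ [k]) i)"
    by (simp add: Ex_less_Suc)
  ultimately show ?thesis unfolding arcs by blast
qed

lemma arcs_starlike_tree_snoc_0: "parcs (starlike_tree (as @ [0])) = parcs (starlike_tree as)"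
  using arcs_starlike_tree_snoc[of _ _ as 0] by auto

lemma arcs_starlike_tree_snoc_Suc:
  "(u, v) \<in> parcs (starlike_tree (as @ [Suc k])) \<longleftrightarrow> (u, v) \<in> parcs (starlike_tree (as @ [k])) \<or>
     {u, v} = {if k = 0 then 0 else sum_list as + k, Suc (sum_list as + k)}"
  unfolding arcs_starlike_tree_snoc Ex_less_Suc by blast

lemma arcs_starlike_tree_le:
  assumes "(u, v) \<in> parcs (starlike_tree as)"
  shows "u \<le> sum_list as \<and> v \<le> sum_list as"
proof -
  interpret pair_graph "starlike_tree as" by (rule pair_graph_starlike_tree)
  show ?thesis using in_arcsD1[OF assms] in_arcsD2[OF assms] by (simp add: starlike_tree_def)
qed

lemma arcs_starlike_tree_snoc_Suc_old:
  assumes "u \<le> sum_list as + k" "v \<le> sum_list as + k"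
  shows "(u, v) \<in> parcs (starlike_tree (as @ [Suc k])) \<longleftrightarrow> (u, v) \<in> parcs (starlike_tree (as @ [k]))"
  using assms by (auto simp: arcs_starlike_tree_snoc_Suc doubleton_eq_iff)

text \<open>The new end has the largest label, so no old arc meets it. Its neighbour is the previous
  end of the arm, which is the centre if \<open>k = 0\<close>.\<close>

lemma arcs_starlike_tree_snoc_Suc_new:
  assumes "u \<le> sum_list as + k"
  shows "(u, Suc (sum_list as + k)) \<in> parcs (starlike_tree (as @ [Suc k]))
      \<longleftrightarrow> u = (if k = 0 then 0 else sum_list as + k)"
    and "(Suc (sum_list as + k), u) \<in> parcs (starlike_tree (as @ [Suc k]))
      \<longleftrightarrow> u = (if k = 0 then 0 else sum_list as + k)"
  using assms arcs_starlike_tree_le[of u "Suc (sum_list as + k)" "as @ [k]"]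
    arcs_starlike_tree_le[of "Suc (sum_list as + k)" u "as @ [k]"]
  by (auto simp: arcs_starlike_tree_snoc_Suc doubleton_eq_iff)

lemma arc_mat_snoc_Suc:
  "arc_mat x (parcs (starlike_tree (as @ [Suc k]))) (Suc (sum_list as + k))
     = arc_mat x (parcs (starlike_tree (as @ [k]))) (Suc (sum_list as + k))"
  by (rule arc_mat_cong) (simp add: arcs_starlike_tree_snoc_Suc_old)

lemma tree_det_snoc_0: "tree_det x (as @ [0]) = tree_det x as"
  by (simp add: tree_det_def arcs_starlike_tree_snoc_0)

lemma forest_det_snoc_0: "forest_det x (as @ [0]) = forest_det x as"
  by (simp add: forest_det_def arcs_starlike_tree_snoc_0)

lemma tree_det_snoc_1: "tree_det x (as @ [Suc 0]) = x * tree_det x as - forest_det x as"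
  using det_arc_mat_pendant[of 0 "Suc (sum_list as)" "parcs (starlike_tree (as @ [Suc 0]))" x]
    arc_mat_snoc_Suc[of x as 0] arcs_starlike_tree_snoc_Suc_new[of _ as 0]
  by (simp add: tree_det_def forest_det_def arcs_starlike_tree_snoc_0 less_Suc_eq_le)

text \<open>The new leaf hangs on the vertex with the next largest label, so deleting both again
  leaves a leading submatrix.\<close>

lemma tree_det_snoc_Suc_Suc:
  "tree_det x (as @ [Suc (Suc k)]) = x * tree_det x (as @ [Suc k]) - tree_det x (as @ [k])"
proof -
  let ?s = "sum_list as + Suc k"
  have "det (arc_mat x (parcs (starlike_tree (as @ [Suc (Suc k)]))) (Suc (Suc ?s)))
      = x * det (arc_mat x (parcs (starlike_tree (as @ [Suc (Suc k)]))) (Suc ?s))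
        - det (mat_delete (arc_mat x (parcs (starlike_tree (as @ [Suc (Suc k)]))) (Suc ?s)) ?s ?s)"
    by (rule det_arc_mat_pendant) (use arcs_starlike_tree_snoc_Suc_new[of _ as "Suc k"] in auto)
  moreover have "arc_mat x (parcs (starlike_tree (as @ [Suc (Suc k)]))) ?s
      = arc_mat x (parcs (starlike_tree (as @ [k]))) ?s"
    by (rule arc_mat_cong) (simp add: arcs_starlike_tree_snoc_Suc_old)
  ultimately show ?thesis
    using arc_mat_snoc_Suc[of x as "Suc k"] by (simp add: tree_det_def mat_delete_arc_mat_last)
qed

lemma forest_det_eq:
  "forest_det x as = det (arc_mat x {(i, j). (Suc i, Suc j) \<in> parcs (starlike_tree as)} (sum_list as))"
  by (simp add: forest_det_def mat_delete_arc_mat_first)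

lemma forest_mat_snoc_Suc:
  "arc_mat x {(i, j). (Suc i, Suc j) \<in> parcs (starlike_tree (as @ [Suc k]))} (sum_list as + k)
     = arc_mat x {(i, j). (Suc i, Suc j) \<in> parcs (starlike_tree (as @ [k]))} (sum_list as + k)"
  by (rule arc_mat_cong) (simp add: arcs_starlike_tree_snoc_Suc_old)

lemma forest_det_snoc_1: "forest_det x (as @ [Suc 0]) = x * forest_det x as"
  using det_arc_mat_isolated[of "sum_list as" "{(i, j). (Suc i, Suc j) \<in> parcs (starlike_tree (as @ [Suc 0]))}" x]
    forest_mat_snoc_Suc[of x as 0] arcs_starlike_tree_snoc_Suc_new(2)[of _ as 0]
  by (simp add: forest_det_eq arcs_starlike_tree_snoc_0 Suc_le_eq)

lemma forest_det_snoc_Suc_Suc: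
  "forest_det x (as @ [Suc (Suc k)]) = x * forest_det x (as @ [Suc k]) - forest_det x (as @ [k])"
proof -
  let ?s = "sum_list as + k"
  let ?E = "{(i, j). (Suc i, Suc j) \<in> parcs (starlike_tree (as @ [Suc (Suc k)]))}"
  have "det (arc_mat x ?E (Suc (Suc ?s)))
      = x * det (arc_mat x ?E (Suc ?s)) - det (mat_delete (arc_mat x ?E (Suc ?s)) ?s ?s)"
    by (rule det_arc_mat_pendant) (use arcs_starlike_tree_snoc_Suc_new[of _ as "Suc k"] in auto)
  moreover have "arc_mat x ?E ?s = arc_mat x {(i, j). (Suc i, Suc j) \<in> parcs (starlike_tree (as @ [k]))} ?s"
    by (rule arc_mat_cong) (simp add: arcs_starlike_tree_snoc_Suc_old)
  ultimately show ?thesis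
    using forest_mat_snoc_Suc[of x as "Suc k"]
    by (simp add: forest_det_eq mat_delete_arc_mat_last)
qed

lemma forest_det_snoc: "forest_det x (as @ [k]) = path_poly x k * forest_det x as"
  by (induction x k rule: path_poly.induct)
    (simp_all add: forest_det_snoc_0 forest_det_snoc_1 forest_det_snoc_Suc_Suc algebra_simps)

text \<open>The rule for the edge between the centre and the new arm: the first product belongs to
  the graph without this edge, the second to the graph without its two ends. Both sides obey the
  recursion of \<open>path_poly\<close> in \<open>k\<close>.\<close>

lemma tree_det_snoc:
  "tree_det x (as @ [Suc k]) = path_poly x (Suc k) * tree_det x as - path_poly x k * forest_det x as"
proof (induction x k rule: path_poly.induct)
  case (3 x k)
  show ?case
    unfolding tree_det_snoc_Suc_Suc[of x as "Suc k"] 3 by (simp add: algebra_simps)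
qed (simp_all add: tree_det_snoc_0 tree_det_snoc_1 tree_det_snoc_Suc_Suc algebra_simps)

lemma forest_det_Nil: "forest_det x [] = 1"
  by (simp add: forest_det_eq arc_mat_def)

lemma tree_det_Nil: "tree_det x [] = x"
  by (simp add: tree_det_def arc_mat_def det_single)

section \<open>Coulson's method\<close>

text \<open>Primitive of \<open>ln (1 + a\<^sup>2 / t\<^sup>2)\<close> on \<open>t > 0\<close> that vanishes at \<open>0\<close>; since \<open>t / 0 = 0\<close> it is the
  right one (zero) also for \<open>a = 0\<close>.\<close>

definition coulson :: "real \<Rightarrow> real \<Rightarrow> real" where
  "coulson a t = t * ln (1 + a\<^sup>2 / t\<^sup>2) + 2 * a * arctan (t / a)"

lemma coulson_deriv:
  assumes "a \<ge> 0" "t > 0"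
  shows "((\<lambda>t. coulson a t) has_real_derivative ln (1 + a\<^sup>2 / t\<^sup>2)) (at t)"
proof (cases "a = 0")
  case True
  then show ?thesis by (simp add: coulson_def)
next
  case False
  then have "a > 0" using assms by simp
  then have pos: "1 + a\<^sup>2 / t\<^sup>2 > 0" "t\<^sup>2 + a\<^sup>2 > 0" "1 + (t / a)\<^sup>2 > 0"
    using assms by (auto intro!: add_pos_nonneg add_nonneg_pos)
  have 1: "((\<lambda>t. 1 + a\<^sup>2 / t\<^sup>2) has_real_derivative - 2 * a\<^sup>2 / t ^ 3) (at t)"
    using assms by (auto intro!: derivative_eq_intros simp: power2_eq_square power3_eq_cube mult_ac)
  have 2: "((\<lambda>t. t / a) has_real_derivative 1 / a) (at t)"
    using False by (auto intro!: derivative_eq_intros)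
  have "((\<lambda>t. coulson a t) has_real_derivative
      1 * ln (1 + a\<^sup>2 / t\<^sup>2) + 1 / (1 + a\<^sup>2 / t\<^sup>2) * (- 2 * a\<^sup>2 / t ^ 3) * t
        + 2 * a * (inverse (1 + (t / a)\<^sup>2) * (1 / a))) (at t)"
    unfolding coulson_def
    by (intro DERIV_add DERIV_mult DERIV_cmult DERIV_ident
        DERIV_chain2[OF DERIV_ln_divide[OF pos(1)] 1] DERIV_chain2[OF DERIV_arctan 2])
  \<comment> \<open>This rational part and the one from the arctangent below cancel.\<close>
  moreover have "1 / (1 + a\<^sup>2 / t\<^sup>2) * (- 2 * a\<^sup>2 / t ^ 3) * t = - 2 * a\<^sup>2 / (t\<^sup>2 + a\<^sup>2)"
  proof -
    have "1 + a\<^sup>2 / t\<^sup>2 = (t\<^sup>2 + a\<^sup>2) / t\<^sup>2" using assms by (simp add: field_simps)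
    then show ?thesis using assms by (simp add: power2_eq_square power3_eq_cube)
  qed
  moreover have "2 * a * (inverse (1 + (t / a)\<^sup>2) * (1 / a)) = 2 * a\<^sup>2 / (t\<^sup>2 + a\<^sup>2)"
  proof -
    have "1 + (t / a)\<^sup>2 = (t\<^sup>2 + a\<^sup>2) / a\<^sup>2" using \<open>a > 0\<close> by (simp add: field_simps)
    then show ?thesis using \<open>a > 0\<close> by simp
  qed
  ultimately show ?thesis by simp
qed

lemma coulson_at_0: "a \<ge> 0 \<Longrightarrow> (coulson a \<longlongrightarrow> 0) (at_right 0)"
proof (cases "a = 0")
  case False
  moreover assume "a \<ge> 0"
  ultimately have "a > 0" by simp
  then show ?thesis unfolding coulson_def by real_asymp
qed (simp add: coulson_def[abs_def])

text \<open>The logarithmic part tends to 0 and the arctangent to \<open>pi / 2\<close>.\<close>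

lemma coulson_at_top: "a \<ge> 0 \<Longrightarrow> (coulson a \<longlongrightarrow> pi * a) at_top"
proof (cases "a = 0")
  case False
  moreover assume "a \<ge> 0"
  ultimately have "a > 0" by simp
  then show ?thesis unfolding coulson_def by real_asymp
qed (simp add: coulson_def[abs_def])

lemma tendsto_sum_mset:
  fixes f :: "'a \<Rightarrow> 'b \<Rightarrow> 'c :: topological_comm_monoid_add"
  assumes "\<And>a. a \<in># A \<Longrightarrow> (f a \<longlongrightarrow> l a) F"
  shows "((\<lambda>t. \<Sum>a\<in>#A. f a t) \<longlongrightarrow> (\<Sum>a\<in>#A. l a)) F"
  using assms by (induction A) (simp_all add: tendsto_add)

lemma prod_mset_pos: "(\<And>a. a \<in># A \<Longrightarrow> f a > 0) \<Longrightarrow> (\<Prod>a\<in>#A. f a :: real) > 0"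
  by (induction A) auto

lemma sum_coulson_deriv:
  assumes "\<And>a. a \<in># A \<Longrightarrow> a \<ge> 0" "t > 0"
  shows "((\<lambda>t. \<Sum>a\<in>#A. coulson a t) has_real_derivative ln (\<Prod>a\<in>#A. 1 + a\<^sup>2 / t\<^sup>2)) (at t)"
  using assms(1)
proof (induction A)
  case (add a A)
  have pos: "1 + b\<^sup>2 / t\<^sup>2 > 0" for b :: real by (auto intro!: add_pos_nonneg)
  have "(\<Prod>a\<in>#A. 1 + a\<^sup>2 / t\<^sup>2) > 0" by (rule prod_mset_pos) (rule pos)
  from ln_mult_pos[OF pos[of a] this] have "ln (\<Prod>a\<in>#add_mset a A. 1 + a\<^sup>2 / t\<^sup>2)
      = ln (1 + a\<^sup>2 / t\<^sup>2) + ln (\<Prod>a\<in>#A. 1 + a\<^sup>2 / t\<^sup>2)"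
    by simp
  moreover have "((\<lambda>t. coulson a t + (\<Sum>a\<in>#A. coulson a t)) has_real_derivative
      ln (1 + a\<^sup>2 / t\<^sup>2) + ln (\<Prod>a\<in>#A. 1 + a\<^sup>2 / t\<^sup>2)) (at t)"
    using add assms(2) by (intro DERIV_add coulson_deriv) auto
  ultimately show ?case by simp
qed simp

lemma prod_mset_scale:
  assumes "t > 0"
  shows "(\<Prod>a\<in>#A. 1 + a\<^sup>2 / t\<^sup>2) = (\<Prod>a\<in>#A. t\<^sup>2 + a\<^sup>2) / (t\<^sup>2 :: real) ^ size A"
  using assms by (induction A) (auto simp: field_simps)

text \<open>The difference \<open>H\<close> of the sums of \<open>coulson\<close> has nonnegative
  derivative and tends to 0 at 0, so it stays nonnegative; its limit at infinity is
  \<open>pi\<close> times the difference of the two sums. Using primitives avoids improper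
  integrals.\<close>

lemma sum_mset_le_if_prod_le:
  fixes A B :: "real multiset"
  assumes nonneg: "\<And>a. a \<in># A \<Longrightarrow> a \<ge> 0" "\<And>b. b \<in># B \<Longrightarrow> b \<ge> 0"
    and size: "size A = size B"
    and le: "\<And>t. t > 0 \<Longrightarrow> (\<Prod>a\<in>#A. t\<^sup>2 + a\<^sup>2) \<le> (\<Prod>b\<in>#B. t\<^sup>2 + b\<^sup>2)"
  shows "sum_mset A \<le> sum_mset B"
proof -
  define H where "H t = (\<Sum>b\<in>#B. coulson b t) - (\<Sum>a\<in>#A. coulson a t)" for t
  have deriv: "\<exists>y. (H has_real_derivative y) (at t) \<and> y \<ge> 0" if "t > 0" for t
  proof (intro exI conjI)
    show "(H has_real_derivative ln (\<Prod>a\<in>#B. 1 + a\<^sup>2 / t\<^sup>2) - ln (\<Prod>a\<in>#A. 1 + a\<^sup>2 / t\<^sup>2)) (at t)"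
      unfolding H_def using that nonneg by (intro DERIV_diff sum_coulson_deriv) auto
    have "(\<Prod>a\<in>#A. 1 + a\<^sup>2 / t\<^sup>2) > 0" by (rule prod_mset_pos) (auto intro!: add_pos_nonneg)
    \<comment> \<open>Equal sizes give both products the same power of \<open>t\<^sup>2\<close> as
      denominator.\<close>
    moreover have "(\<Prod>a\<in>#A. 1 + a\<^sup>2 / t\<^sup>2) \<le> (\<Prod>a\<in>#B. 1 + a\<^sup>2 / t\<^sup>2)"
      using le[OF that] that by (simp add: prod_mset_scale size divide_right_mono)
    ultimately show "ln (\<Prod>a\<in>#B. 1 + a\<^sup>2 / t\<^sup>2) - ln (\<Prod>a\<in>#A. 1 + a\<^sup>2 / t\<^sup>2) \<ge> 0"
      by simp
  qed
  have mono: "H s \<le> H t" if "0 < s" "s \<le> t" for s t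
    by (rule DERIV_nonneg_imp_nondecreasing[OF that(2)]) (use deriv that in force)
  have "(H \<longlongrightarrow> (\<Sum>b\<in>#B. 0) - (\<Sum>a\<in>#A. 0)) (at_right 0)"
    unfolding H_def using nonneg by (intro tendsto_diff tendsto_sum_mset coulson_at_0) auto
  then have H0: "(H \<longlongrightarrow> 0) (at_right 0)" by simp
  have H_nonneg: "H t \<ge> 0" if "t > 0" for t
  proof (rule tendsto_upperbound[OF H0])
    show "\<forall>\<^sub>F s in at_right 0. H s \<le> H t"
      unfolding eventually_at_right_field using that mono by (intro exI[of _ t]) auto
  qed simp
  have "(H \<longlongrightarrow> (\<Sum>b\<in>#B. pi * b) - (\<Sum>a\<in>#A. pi * a)) at_top"
    unfolding H_def using nonneg by (intro tendsto_diff tendsto_sum_mset coulson_at_top) auto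
  then have nonneg_lim: "0 \<le> (\<Sum>b\<in>#B. pi * b) - (\<Sum>a\<in>#A. pi * a)"
    by (rule tendsto_lowerbound) (auto intro: eventually_mono[OF eventually_gt_at_top[of 0]] H_nonneg)
  have sum_pi: "(\<Sum>c\<in>#C. pi * c) = pi * sum_mset C" for C :: "real multiset"
    by (induction C) (simp_all add: distrib_left)
  have "pi * sum_mset A \<le> pi * sum_mset B"
    using nonneg_lim unfolding sum_pi by linarith
  then show ?thesis by (rule mult_left_le_imp_le) simp
qed

section \<open>Energy and the roots of the characteristic polynomial\<close>

lemma arcs_starlike_tree_sym:
  "(u, v) \<in> parcs (starlike_tree as) \<longleftrightarrow> (v, u) \<in> parcs (starlike_tree as)"
  by (simp add: starlike_tree_def insert_commute)

lemma adjacency_mat_starlike_tree: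
  "adjacency_mat (starlike_tree as) = mat (Suc (sum_list as)) (Suc (sum_list as))
     (\<lambda>(i, j). if (i, j) \<in> parcs (starlike_tree as) then 1 else 0)"
proof -
  have "sorted_list_of_set {0..sum_list as} = [0..<Suc (sum_list as)]"
    by (metis atLeastLessThanSuc_atLeastAtMost sorted_list_of_set_range)
  moreover have "pverts (starlike_tree as) = {0..sum_list as}" by (simp add: starlike_tree_def)
  ultimately show ?thesis
    unfolding adjacency_mat_def Let_def by (intro eq_matI) (auto simp del: upt_Suc)
qed

lemma adjacency_mat_starlike_tree_carrier:
  "adjacency_mat (starlike_tree as) \<in> carrier_mat (Suc (sum_list as)) (Suc (sum_list as))"
  by (simp add: adjacency_mat_starlike_tree)

lemma poly_starlike_poly:
  "poly (char_poly (adjacency_mat (starlike_tree as))) z = tree_det z as"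
proof -
  interpret pair_graph "starlike_tree as" by (rule pair_graph_starlike_tree)
  \<comment> \<open>\<open>arc_mat\<close> has \<open>z\<close> on the diagonal whatever the arcs
    are, so loops must be excluded.\<close>
  have "(i, i) \<notin> parcs (starlike_tree as)" for i
    using pair_no_loops[of "(i, i)"] by auto
  then have "- char_matrix (adjacency_mat (starlike_tree as)) z
      = arc_mat z (parcs (starlike_tree as)) (Suc (sum_list as))"
    by (intro eq_matI) (auto simp: char_matrix_def adjacency_mat_starlike_tree arc_mat_def)
  then show ?thesis
    by (simp add: char_poly_matrix[OF adjacency_mat_starlike_tree_carrier] tree_det_def)
qed

text \<open>For an eigenvector \<open>v\<close> the form \<open>S\<close> equals
  \<open>x * N\<close> with \<open>N > 0\<close>, while symmetry and real entries make
  \<open>S\<close> its own conjugate.\<close>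

lemma eigenvalue_real_symmetric:
  fixes A :: "complex mat"
  assumes A: "A \<in> carrier_mat n n"
    and sym: "\<And>i j. i < n \<Longrightarrow> j < n \<Longrightarrow> A $$ (i, j) = A $$ (j, i)"
    and real: "\<And>i j. i < n \<Longrightarrow> j < n \<Longrightarrow> A $$ (i, j) \<in> \<real>"
    and ev: "eigenvalue A x"
  shows "Im x = 0"
proof -
  obtain v where v: "v \<in> carrier_vec n" "v \<noteq> 0\<^sub>v n" and Av: "A *\<^sub>v v = x \<cdot>\<^sub>v v"
    using ev A unfolding eigenvalue_def eigenvector_def by auto
  have row: "(\<Sum>j<n. A $$ (i, j) * v $ j) = x * v $ i" if i: "i < n" for i
  proof -
    have "(A *\<^sub>v v) $ i = (\<Sum>j<n. A $$ (i, j) * v $ j)"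
      using A v i by (auto simp: scalar_prod_def lessThan_atLeast0 intro!: sum.cong)
    then show ?thesis using Av v i by simp
  qed
  define S where "S = (\<Sum>i<n. \<Sum>j<n. cnj (v $ i) * A $$ (i, j) * v $ j)"
  define N where "N = (\<Sum>i<n. (cmod (v $ i))\<^sup>2)"
  have "S = (\<Sum>i<n. cnj (v $ i) * (\<Sum>j<n. A $$ (i, j) * v $ j))"
    by (simp add: S_def sum_distrib_left mult.assoc)
  also have "\<dots> = (\<Sum>i<n. x * of_real ((cmod (v $ i))\<^sup>2))"
  proof (intro sum.cong refl)
    fix i assume "i \<in> {..<n}"
    then have "cnj (v $ i) * (\<Sum>j<n. A $$ (i, j) * v $ j) = x * (v $ i * cnj (v $ i))"
      using row by simp
    then show "cnj (v $ i) * (\<Sum>j<n. A $$ (i, j) * v $ j) = x * of_real ((cmod (v $ i))\<^sup>2)"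
      by (simp only: complex_norm_square)
  qed
  finally have S: "S = x * of_real N" by (simp add: N_def sum_distrib_left)
  have "cnj S = (\<Sum>i<n. \<Sum>j<n. v $ i * A $$ (i, j) * cnj (v $ j))"
    using real by (simp add: S_def cnj_sum Reals_cnj_iff)
  also have "\<dots> = (\<Sum>j<n. \<Sum>i<n. v $ i * A $$ (i, j) * cnj (v $ j))" by (rule sum.swap)
  also have "\<dots> = S" unfolding S_def by (intro sum.cong) (auto simp: sym mult_ac)
  finally have "cnj S = S" .
  moreover obtain i where "i < n" "v $ i \<noteq> 0"
    using v by (metis eq_vecI carrier_vecD index_zero_vec)
  then have "N > 0" unfolding N_def by (intro sum_pos2[of _ i]) auto
  ultimately have "cnj x = x" unfolding S by simp
  then show ?thesis by (simp add: complex_eq_iff)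
qed

lemma sum_mset_eq_sum_count:
  "(\<Sum>x\<in>#M. f x) = (\<Sum>x\<in>set_mset M. real (count M x) * f x)"
proof (induction M)
  case (add a M)
  \<comment> \<open>If \<open>a\<close> does not occur in \<open>M\<close>, its count 0 adds
    nothing.\<close>
  have "(\<Sum>x\<in>insert a (set_mset M). real (count M x) * f x) = (\<Sum>x\<in>set_mset M. real (count M x) * f x)"
    by (rule sum.mono_neutral_right) (auto simp: not_in_iff)
  moreover have "(\<Sum>x\<in>insert a (set_mset M). real (count (add_mset a M) x) * f x)
      = (\<Sum>x\<in>insert a (set_mset M). real (count M x) * f x + (if x = a then f x else 0))"
    by (intro sum.cong) (auto simp: algebra_simps)
  ultimately show ?case using add by (simp add: sum.distrib)
qed simp

abbreviation starlike_poly :: "nat list \<Rightarrow> complex poly" where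
  "starlike_poly as \<equiv> char_poly (adjacency_mat (starlike_tree as))"

lemma starlike_poly_monic: "degree (starlike_poly as) = Suc (sum_list as)"
  "lead_coeff (starlike_poly as) = 1"
  using degree_monic_char_poly[OF adjacency_mat_starlike_tree_carrier] by auto

lemma energy_starlike_tree: "energy (starlike_tree as) = (\<Sum>x\<in>#proots (starlike_poly as). cmod x)"
proof -
  have "starlike_poly as \<noteq> 0" using starlike_poly_monic(2)[of as] by auto
  then show ?thesis
    unfolding energy_def spectrum_root_char_poly[OF adjacency_mat_starlike_tree_carrier]
    by (simp add: sum_mset_eq_sum_count)
qed

text \<open>The roots are real, so each contributes \<open>t\<^sup>2 + x\<^sup>2\<close>. Squaring
  the modulus avoids pairing roots of opposite sign.\<close>

lemma norm_tree_det_eq_prod: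
  "(cmod (tree_det (\<i> * of_real t) as))\<^sup>2 = (\<Prod>x\<in>#proots (starlike_poly as). t\<^sup>2 + (cmod x)\<^sup>2)"
proof -
  have "starlike_poly as \<noteq> 0" using starlike_poly_monic(2)[of as] by auto
  have "(\<Prod>x\<in>#proots (starlike_poly as). [:-x, 1:]) = starlike_poly as"
    using complex_poly_decompose_multiset[of "starlike_poly as"] unfolding starlike_poly_monic(2) by simp
  moreover have "poly (\<Prod>x\<in>#M. [:-x, 1:]) z = (\<Prod>x\<in>#M. z - x)" for M and z :: complex
    by (induction M) (auto simp: algebra_simps)
  ultimately have "tree_det z as = (\<Prod>x\<in>#proots (starlike_poly as). z - x)" for z
    by (metis poly_starlike_poly)
  moreover have "(cmod (\<Prod>x\<in>#M. z - x))\<^sup>2 = (\<Prod>x\<in>#M. (cmod (z - x))\<^sup>2)" for M z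
    by (induction M) (auto simp: norm_mult power_mult_distrib)
  moreover have "(cmod (\<i> * of_real t - x))\<^sup>2 = t\<^sup>2 + (cmod x)\<^sup>2" if "x \<in># proots (starlike_poly as)" for x
  proof -
    have "eigenvalue (adjacency_mat (starlike_tree as)) x"
      using that \<open>starlike_poly as \<noteq> 0\<close> eigenvalue_root_char_poly[OF adjacency_mat_starlike_tree_carrier]
      by simp
    then have "Im x = 0"
      by (rule eigenvalue_real_symmetric[OF adjacency_mat_starlike_tree_carrier, rotated -1])
        (auto simp: adjacency_mat_starlike_tree arcs_starlike_tree_sym)
    then show ?thesis by (simp add: cmod_power2)
  qed
  ultimately show ?thesis by (simp cong: image_mset_cong)
qed

section \<open>Values on the imaginary axis\<close>

text \<open>The path polynomial at \<open>\<i> * t\<close> without its factor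
  \<open>\<i> ^ k\<close>; the minus of the recursion turns into a plus.\<close>

fun path_poly_im :: "real \<Rightarrow> nat \<Rightarrow> real" where
  "path_poly_im t 0 = 1"
| "path_poly_im t (Suc 0) = t"
| "path_poly_im t (Suc (Suc k)) = t * path_poly_im t (Suc k) + path_poly_im t k"

lemma path_poly_im_nonneg: "t \<ge> 0 \<Longrightarrow> path_poly_im t k \<ge> 0"
  by (induction t k rule: path_poly_im.induct) auto

lemma path_poly_imaginary: "path_poly (\<i> * of_real t) k = \<i> ^ k * of_real (path_poly_im t k)"
  by (induction t k rule: path_poly_im.induct) (simp_all add: algebra_simps)

text \<open>The convergents \<open>path_poly_im t (Suc m) / path_poly_im t m\<close> of the continued fraction
  \<open>t + 1 / (t + 1 / (t + \<dots>))\<close> alternate around their limit, so from \<open>m = 2\<close> on the one for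
  \<open>m = 3\<close> is the largest.\<close>

lemma path_poly_im_ratio:
  assumes "t \<ge> 0" "m \<ge> 2"
  shows "path_poly_im t 3 * path_poly_im t (Suc m) \<le> path_poly_im t 4 * path_poly_im t m"
  using assms(2)
proof (induction m rule: less_induct)
  case (less m)
  consider "m = 2" | "m = 3" | k where "m = Suc (Suc k)" "k \<ge> 2"
    by (metis Suc_le_D less.prems numeral_2_eq_2 numeral_3_eq_3 le_antisym not_less_eq_eq le_SucE Suc_le_mono)
  then show ?case
  proof cases
    case 1
    then show ?thesis by (simp add: eval_nat_numeral algebra_simps)
  next
    case 2
    then show ?thesis by (simp add: eval_nat_numeral)
  next
    case (3 k)
    have "path_poly_im t 3 * path_poly_im t (Suc k) \<le> path_poly_im t 4 * path_poly_im t k"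
      "path_poly_im t 3 * path_poly_im t (Suc (Suc k)) \<le> path_poly_im t 4 * path_poly_im t (Suc k)"
      using less.IH[of k] less.IH[of "Suc k"] 3 by auto
    \<comment> \<open>Both sides obey the recursion of \<open>path_poly_im\<close>: \<open>t\<close>
      times the case \<open>Suc k\<close> plus the case \<open>k\<close> is the claim.\<close>
    from add_mono[OF mult_left_mono[OF this(2) assms(1)] this(1)] show ?thesis
      by (simp add: 3 algebra_simps)
  qed
qed

lemma tree_det_snoc_2: "tree_det z (as @ [2]) = (z\<^sup>2 - 1) * tree_det z as - z * forest_det z as"
  using tree_det_snoc[of z as 1] by (simp add: power2_eq_square numeral_2_eq_2)

lemma forest_det_snoc_2: "forest_det z (as @ [2]) = (z\<^sup>2 - 1) * forest_det z as"
  using forest_det_snoc[of z as 2] by (simp add: power2_eq_square numeral_2_eq_2)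

text \<open>Differences between the three equal arms give eigenvectors vanishing at the centre,
  whence the factor \<open>(z\<^sup>2 - 1)\<^sup>2\<close>.\<close>

lemma tree_det_222:
  "tree_det z [2, 2, 2, Suc k]
     = (z\<^sup>2 - 1)\<^sup>2 * ((z ^ 3 - 4 * z) * path_poly z (Suc k) - (z\<^sup>2 - 1) * path_poly z k)"
proof -
  have T: "tree_det z [2] = (z\<^sup>2 - 1) * z - z" and F: "forest_det z [2] = z\<^sup>2 - 1"
    using tree_det_snoc_2[of z "[]"] forest_det_snoc_2[of z "[]"]
    by (simp_all add: tree_det_Nil forest_det_Nil)
  have T2: "tree_det z [2, 2] = (z\<^sup>2 - 1) * tree_det z [2] - z * forest_det z [2]"
    and F2: "forest_det z [2, 2] = (z\<^sup>2 - 1) * forest_det z [2]"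
    using tree_det_snoc_2[of z "[2]"] forest_det_snoc_2[of z "[2]"] by simp_all
  have T3: "tree_det z [2, 2, 2] = (z\<^sup>2 - 1) * tree_det z [2, 2] - z * forest_det z [2, 2]"
    and F3: "forest_det z [2, 2, 2] = (z\<^sup>2 - 1) * forest_det z [2, 2]"
    using tree_det_snoc_2[of z "[2, 2]"] forest_det_snoc_2[of z "[2, 2]"] by simp_all
  have "tree_det z [2, 2, 2, Suc k]
      = path_poly z (Suc k) * tree_det z [2, 2, 2] - path_poly z k * forest_det z [2, 2, 2]"
    using tree_det_snoc[of z "[2, 2, 2]" k] by simp
  then show ?thesis
    unfolding T3 F3 T2 F2 T F by (simp add: eval_nat_numeral algebra_simps)
qed

text \<open>The centre with arms 2 and 1 is the path on four vertices, whose polynomial is the first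
  coefficient.\<close>

lemma tree_det_21:
  "tree_det z [2, 1, Suc k] = (z ^ 4 - 3 * z\<^sup>2 + 1) * path_poly z (Suc k) - (z ^ 3 - z) * path_poly z k"
proof -
  have T: "tree_det z [2] = (z\<^sup>2 - 1) * z - z" and F: "forest_det z [2] = z\<^sup>2 - 1"
    using tree_det_snoc_2[of z "[]"] forest_det_snoc_2[of z "[]"]
    by (simp_all add: tree_det_Nil forest_det_Nil)
  have T2: "tree_det z [2, 1] = z * tree_det z [2] - forest_det z [2]"
    and F2: "forest_det z [2, 1] = z * forest_det z [2]"
    using tree_det_snoc_1[of z "[2]"] forest_det_snoc_1[of z "[2]"] by simp_all
  have "tree_det z [2, 1, Suc k] = path_poly z (Suc k) * tree_det z [2, 1] - path_poly z k * forest_det z [2, 1]"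
    using tree_det_snoc[of z "[2, 1]" k] by simp
  then show ?thesis
    unfolding T2 F2 T F by (simp add: eval_nat_numeral algebra_simps)
qed

text \<open>Both summands carry the same unit \<open>\<i> ^ m\<close> and are otherwise nonnegative,
  so their moduli add.\<close>

lemma norm_tree_det_222:
  assumes "t \<ge> 0"
  shows "cmod (tree_det (\<i> * of_real t) [2, 2, 2, Suc m])
    = (t\<^sup>2 + 1)\<^sup>2 * ((t ^ 3 + 4 * t) * path_poly_im t (Suc m) + (t\<^sup>2 + 1) * path_poly_im t m)"
    (is "_ = ?f")
proof -
  have "tree_det (\<i> * of_real t) [2, 2, 2, Suc m] = \<i> ^ m * of_real ?f"
    by (simp add: tree_det_222 path_poly_imaginary power_mult_distrib power3_eq_cube power2_eq_square
        algebra_simps)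
  moreover have "?f \<ge> 0"
    using assms path_poly_im_nonneg[OF assms] by simp
  ultimately show ?thesis by (simp only: norm_mult norm_power norm_ii norm_of_real) simp
qed

text \<open>The recursion is unfolded until only the two path values used for the other tree
  remain.\<close>

lemma norm_tree_det_21:
  assumes "t \<ge> 0"
  shows "cmod (tree_det (\<i> * of_real t) [2, 1, Suc (Suc (Suc (Suc m)))])
    = (t ^ 7 + 6 * t ^ 5 + 9 * t ^ 3 + 3 * t) * path_poly_im t (Suc m)
      + (t ^ 6 + 5 * t ^ 4 + 5 * t\<^sup>2 + 1) * path_poly_im t m" (is "_ = ?f")
proof -
  have "tree_det (\<i> * of_real t) [2, 1, Suc (Suc (Suc (Suc m)))] = \<i> ^ m * of_real ?f"
    unfolding tree_det_21
    by (simp add: path_poly_imaginary power_mult_distrib eval_nat_numeral algebra_simps)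
  moreover have "?f \<ge> 0"
    using assms path_poly_im_nonneg[OF assms] by simp
  ultimately show ?thesis by (simp only: norm_mult norm_power norm_ii norm_of_real) simp
qed

section \<open>Comparison of the two trees\<close>

text \<open>The right side minus the left is \<open>(C * B - A * D) * (d * b - c * a)\<close>: the
  quotient of \<open>C * a + D * b\<close> by \<open>A * a + B * b\<close> grows with
  \<open>a / b\<close>.\<close>

lemma cross_ratio_mono:
  fixes a b c d A B C D :: real
  assumes "0 \<le> A" "A \<le> C" "0 \<le> D" "D \<le> B" and "c * a \<le> d * b"
  shows "(C * a + D * b) * (A * d + B * c) \<le> (A * a + B * b) * (C * d + D * c)"
proof -
  have "A * D \<le> C * B" using assms by (intro mult_mono) auto
  then have "0 \<le> (C * B - A * D) * (d * b - c * a)" using assms by (intro mult_nonneg_nonneg) auto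
  then show ?thesis by (simp add: algebra_simps)
qed

text \<open>The list entries are the positive eigenvalues for \<open>n = 11\<close>, rounded down for the tree
  \<open>[2, 1, 7]\<close> and up for \<open>[2, 2, 2, 4]\<close>, where \<open>1\<close> is an exact double eigenvalue.\<close>

lemma prod_eigenvalues_21_le:
  fixes s :: real
  assumes "s \<ge> 0"
  shows "(\<Prod>b\<leftarrow>[11/20, 17/20, 67/50, 1769/1000, 201/100]. s + b\<^sup>2)
    \<le> s ^ 5 + 10 * s ^ 4 + 35 * s ^ 3 + 51 * s\<^sup>2 + 29 * s + 5"
proof -
  \<comment> \<open>Rounding down raises no coefficient of the expanded product, so coefficients are
    compared one by one.\<close>
  have "(\<Prod>b\<leftarrow>[11/20, 17/20, 67/50, 1769/1000, 201/100]. s + b\<^sup>2)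
      = s ^ 5 + 9990061/1000000 * s ^ 4 + 349241593227/10000000000 * s ^ 3
        + 5081534362849891/100000000000000 * s\<^sup>2 + 230767686911562377/8000000000000000 * s
        + 19846347854685848001/4000000000000000000"
    by (simp add: eval_nat_numeral algebra_simps add_divide_distrib)
  also have "\<dots> \<le> s ^ 5 + 10 * s ^ 4 + 35 * s ^ 3 + 51 * s\<^sup>2 + 29 * s + 5"
    by (intro add_mono mult_right_mono) (use assms in auto)
  finally show ?thesis .
qed

lemma prod_eigenvalues_222_ge:
  fixes s :: real
  assumes "s \<ge> 0"
  shows "(s + 1)\<^sup>2 * (s ^ 3 + 8 * s\<^sup>2 + 16 * s + 6) \<le> (\<Prod>a\<leftarrow>[1, 1, 349/500, 39/25, 113/50]. s + a\<^sup>2)"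
proof -
  \<comment> \<open>The entries 1, 1 give the factor \<open>(s + 1)\<^sup>2\<close> exactly; only
    the cubic factor is rounded.\<close>
  have "s ^ 3 + 8 * s\<^sup>2 + 16 * s + 6 \<le> s ^ 3 + 2007101/250000 * s\<^sup>2 + 10064973853/625000000 * s
      + 2365576269849/390625000000"
    by (intro add_mono mult_right_mono) (use assms in auto)
  also have "\<dots> = (\<Prod>a\<leftarrow>[349/500, 39/25, 113/50]. s + a\<^sup>2)"
    by (simp add: eval_nat_numeral algebra_simps add_divide_distrib)
  finally have "(s + 1)\<^sup>2 * (s ^ 3 + 8 * s\<^sup>2 + 16 * s + 6)
      \<le> (s + 1)\<^sup>2 * (\<Prod>a\<leftarrow>[349/500, 39/25, 113/50]. s + a\<^sup>2)"
    by (rule mult_left_mono) simp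
  then show ?thesis by (simp add: power2_eq_square mult.assoc)
qed

text \<open>The quotient of the two moduli is at most its value for \<open>m = 3\<close>, which the
  rounded eigenvalues bound by the quotient of the two list products.\<close>

lemma norm_tree_det_le:
  assumes t: "t > 0" and m: "m \<ge> 2"
  shows "cmod (tree_det (\<i> * of_real t) [2, 2, 2, Suc m])
      * (\<Prod>b\<leftarrow>[11/20, 17/20, 67/50, 1769/1000, 201/100]. t\<^sup>2 + b\<^sup>2)
    \<le> cmod (tree_det (\<i> * of_real t) [2, 1, Suc (Suc (Suc (Suc m)))])
      * (\<Prod>a\<leftarrow>[1, 1, 349/500, 39/25, 113/50]. t\<^sup>2 + a\<^sup>2)" (is "?f1 * ?Q2 \<le> ?f2 * ?Q1")
proof -
  \<comment> \<open>Coefficients of the path values at \<open>Suc m\<close> and \<open>m\<close> in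
    the two moduli; inserting \<open>?q4\<close> and \<open>?q3\<close> instead gives the case
    \<open>m = 3\<close>, that is \<open>n = 11\<close>.\<close>
  let ?A = "t ^ 7 + 6 * t ^ 5 + 9 * t ^ 3 + 3 * t" and ?B = "t ^ 6 + 5 * t ^ 4 + 5 * t\<^sup>2 + 1"
  let ?C = "(t\<^sup>2 + 1)\<^sup>2 * (t ^ 3 + 4 * t)" and ?D = "(t\<^sup>2 + 1) ^ 3"
  let ?q3 = "path_poly_im t 3" and ?q4 = "path_poly_im t 4"
  have f1: "?f1 = ?C * path_poly_im t (Suc m) + ?D * path_poly_im t m"
    using t by (simp add: norm_tree_det_222 algebra_simps power2_eq_square power3_eq_cube)
  have f2: "?f2 = ?A * path_poly_im t (Suc m) + ?B * path_poly_im t m"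
    using norm_tree_det_21[of t m] t by simp
  have ratio: "?f1 * (?A * ?q4 + ?B * ?q3) \<le> ?f2 * (?C * ?q4 + ?D * ?q3)"
    unfolding f1 f2
  proof (rule cross_ratio_mono)
    have "?C - ?A = t" "?B - ?D = 2 * t ^ 4 + 2 * t\<^sup>2"
      by (simp_all add: eval_nat_numeral algebra_simps)
    then show "?A \<le> ?C" "?D \<le> ?B" using t by (smt (verit) zero_le_power)+
    show "?q3 * path_poly_im t (Suc m) \<le> ?q4 * path_poly_im t m"
      using path_poly_im_ratio[of t m] t m by simp
  qed (use t in auto)
  \<comment> \<open>The factor \<open>t\<close> stands for the simple eigenvalue 0 of both trees on
    11 vertices; it cancels at the end.\<close>
  have "t * ?Q2 \<le> t * ((t\<^sup>2) ^ 5 + 10 * (t\<^sup>2) ^ 4 + 35 * (t\<^sup>2) ^ 3 + 51 * (t\<^sup>2)\<^sup>2 + 29 * t\<^sup>2 + 5)"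
    by (intro mult_left_mono prod_eigenvalues_21_le) (use t in auto)
  also have "\<dots> = ?A * ?q4 + ?B * ?q3"
    by (simp add: eval_nat_numeral algebra_simps)
  finally have Q2: "t * ?Q2 \<le> ?A * ?q4 + ?B * ?q3" .
  have "?C * ?q4 + ?D * ?q3 = t * ((t\<^sup>2 + 1)\<^sup>2 * ((t\<^sup>2) ^ 3 + 8 * (t\<^sup>2)\<^sup>2 + 16 * t\<^sup>2 + 6))"
    by (simp add: eval_nat_numeral algebra_simps)
  also have "\<dots> \<le> t * ?Q1"
    by (intro mult_left_mono prod_eigenvalues_222_ge) (use t in auto)
  finally have Q1: "?C * ?q4 + ?D * ?q3 \<le> t * ?Q1" .
  have "t * (?f1 * ?Q2) = ?f1 * (t * ?Q2)" by simp
  also have "\<dots> \<le> ?f1 * (?A * ?q4 + ?B * ?q3)" using Q2 by (intro mult_left_mono) auto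
  also note ratio
  also have "?f2 * (?C * ?q4 + ?D * ?q3) \<le> ?f2 * (t * ?Q1)" using Q1 by (intro mult_left_mono) auto
  also have "\<dots> = t * (?f2 * ?Q1)" by simp
  finally show ?thesis using t by simp
qed

theorem theorem5p3:
  fixes n :: nat
  assumes "n \<ge> 10"
  shows "energy (starlike_tree [2, 2, 2, n - 7]) < energy (starlike_tree [2, 1, n - 4])"
proof -
  \<comment> \<open>The path values at \<open>n - 7\<close> and \<open>n - 8\<close> become those at
    \<open>Suc m\<close> and \<open>m\<close>; \<open>n \<ge> 10\<close> gives the bound
    \<open>m \<ge> 2\<close> of the ratio lemma.\<close>
  define m where "m = n - 8"
  have m: "m \<ge> 2" "n - 7 = Suc m" "n - 4 = Suc (Suc (Suc (Suc m)))"
    using assms by (auto simp: m_def)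
  let ?as = "[2, 2, 2, Suc m]" and ?bs = "[2, 1, Suc (Suc (Suc (Suc m)))]"
  define roots where "roots as = image_mset cmod (proots (starlike_poly as))" for as
  \<comment> \<open>The sums are 6.518 and 6.519; the excess of \<open>M2\<close> makes the final
    inequality strict.\<close>
  define M1 M2 :: "real multiset" where "M1 = mset [1, 1, 349/500, 39/25, 113/50]"
    and "M2 = mset [11/20, 17/20, 67/50, 1769/1000, 201/100]"
  \<comment> \<open>\<open>M1\<close> and \<open>M2\<close> are doubled because the products over
    the roots are squared moduli.\<close>
  have "sum_mset (roots ?as + (M2 + M2)) \<le> sum_mset (roots ?bs + (M1 + M1))"
  proof (rule sum_mset_le_if_prod_le)
    show "size (roots ?as + (M2 + M2)) = size (roots ?bs + (M1 + M1))"
      by (simp add: roots_def size_proots_complex starlike_poly_monic(1) M1_def M2_def)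
    fix t :: real
    assume t: "t > 0"
    have "(\<Prod>a\<in>#roots ?as + (M2 + M2). t\<^sup>2 + a\<^sup>2)
        = (cmod (tree_det (\<i> * of_real t) ?as) * (\<Prod>b\<in>#M2. t\<^sup>2 + b\<^sup>2))\<^sup>2"
      by (simp add: roots_def norm_tree_det_eq_prod power_mult_distrib
          multiset.map_comp o_def) (simp add: power2_eq_square)
    also have "\<dots> \<le> (cmod (tree_det (\<i> * of_real t) ?bs) * (\<Prod>a\<in>#M1. t\<^sup>2 + a\<^sup>2))\<^sup>2"
      by (rule power_mono) (use norm_tree_det_le[OF t m(1)] in \<open>auto simp: M1_def M2_def\<close>)
    also have "\<dots> = (\<Prod>b\<in>#roots ?bs + (M1 + M1). t\<^sup>2 + b\<^sup>2)"
      by (simp add: roots_def norm_tree_det_eq_prod power_mult_distrib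
          multiset.map_comp o_def) (simp add: power2_eq_square)
    finally show "(\<Prod>a\<in>#roots ?as + (M2 + M2). t\<^sup>2 + a\<^sup>2) \<le> (\<Prod>b\<in>#roots ?bs + (M1 + M1). t\<^sup>2 + b\<^sup>2)" .
  qed (auto simp: roots_def M1_def M2_def)
  moreover have "energy (starlike_tree as) = sum_mset (roots as)" for as
    by (simp add: energy_starlike_tree roots_def)
  ultimately show ?thesis unfolding m by (simp add: M1_def M2_def)
qed

end
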